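(* Let $t\ge 1$ be an integer. Let $G$ be an ordered graph with $n\ge 2$ vertices, let $a>0$ be a real number, and let $e\in E(G)$ satisfy $\mathrm{h}_G(e)>a$. Then there is an increasing path $P$ in $G$ starting with $e$ and having length at least $$\frac{a^{1-1/t}}{(70\log n)^{2t}},$$ such that $\mathrm{h}_G(f)\ge \mathrm{h}_G(e)-a$ for every $f\in E(P)$.
   Context: An ordered graph is a finite simple graph $G$ equipped with a total order $\le_G$ on $E(G)$ and a total order $\le^V_G$ on $V(G)$. Let $\mathbb N=\{1,2,\dots\}$. Define the lexicographic order $\preceq_{\mathrm{lex}}$ on $\mathbb N\times V(G)$ by $(i,v)\preceq_{\mathrm{lex}}(i',v')$ iff $i<i'$, or $i=i'$ and $v\le^V_G v'$. The height table $\mathrm{HT}(G)$ is a partially filled array indexed by $\mathbb N\times V(G)$, built by going through all $(i,v)\in\mathbb N\times V(G)$ in $\preceq_{\mathrm{lex}}$-increasing order and setting the entry at $(i,v)$ to be the $\le_G$-largest edge containing $v$ that has not yet been entered into the table (leaving the entry blank if every edge containing $v$ has already been entered). Every edge is entered exactly once; for $e\in E(G)$, $\mathrm{ht}_G(e)=(\mathrm{h}_G(e),\mathrm{v}_G(e))$ denotes its position, where the height $\mathrm{h}_G(e)$ is its row and $\mathrm{v}_G(e)$ its column (a vertex of $e$). An increasing path is a path with a specified direction whose consecutive edges are $\le_G$-increasing; its length is its number of edges; "starting with $e$" means $e$ is its first edge. Logarithms are base 2. *)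

theory Defs
  imports Complex_Main
begin

text \<open>An ordered graph: vertex set V (finite, type 'v with its linear order as the
vertex order), edge set E of 2-element subsets of V, and an edge order given by an
injective ranking w on E (e \<le>_G f iff w e \<le> w f).\<close>

definition simple_graph :: "'v set \<Rightarrow> 'v set set \<Rightarrow> bool" where
  "simple_graph V E \<longleftrightarrow> finite V \<and> (\<forall>e\<in>E. \<exists>x y. x \<in> V \<and> y \<in> V \<and> x \<noteq> y \<and> e = {x, y})"

definition ordered_graph :: "'v set \<Rightarrow> 'v set set \<Rightarrow> ('v set \<Rightarrow> nat) \<Rightarrow> bool" where
  "ordered_graph V E w \<longleftrightarrow> simple_graph V E \<and> inj_on w E"

text \<open>Entry of the height table at a vertex v, given the set S of edges already entered:
the w-largest edge containing v not yet entered (None = blank).\<close>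
definition pick :: "'v set set \<Rightarrow> ('v set \<Rightarrow> nat) \<Rightarrow> 'v set set \<Rightarrow> 'v \<Rightarrow> 'v set option" where
  "pick E w S v = (if {f \<in> E - S. v \<in> f} = {} then None
                   else Some (ARG_MAX w f. f \<in> E - S \<and> v \<in> f))"

definition row_step :: "'v::linorder set \<Rightarrow> 'v set set \<Rightarrow> ('v set \<Rightarrow> nat) \<Rightarrow> 'v set set \<Rightarrow> 'v set set" where
  "row_step V E w S = foldl (\<lambda>S v. case pick E w S v of None \<Rightarrow> S | Some f \<Rightarrow> insert f S)
                         S (sorted_list_of_set V)"

definition entered :: "'v::linorder set \<Rightarrow> 'v set set \<Rightarrow> ('v set \<Rightarrow> nat) \<Rightarrow> nat \<Rightarrow> 'v set set" where
  "entered V E w i = (row_step V E w ^^ i) {}"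

definition height :: "'v::linorder set \<Rightarrow> 'v set set \<Rightarrow> ('v set \<Rightarrow> nat) \<Rightarrow> 'v set \<Rightarrow> nat" where
  "height V E w e = (LEAST i. e \<in> entered V E w i)"

definition increasing_path :: "'v set set \<Rightarrow> ('v set \<Rightarrow> nat) \<Rightarrow> 'v list \<Rightarrow> bool" where
  "increasing_path E w ps \<longleftrightarrow> length ps \<ge> 2 \<and> distinct ps \<and>
     (\<forall>k. k + 1 < length ps \<longrightarrow> {ps ! k, ps ! (k+1)} \<in> E) \<and>
     (\<forall>k. k + 2 < length ps \<longrightarrow> w {ps ! k, ps ! (k+1)} < w {ps ! (k+1), ps ! (k+2)})"

definition path_edges :: "'v list \<Rightarrow> 'v set set" where
  "path_edges ps = {{ps ! k, ps ! (k+1)} | k. k + 1 < length ps}"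

definition path_length :: "'v list \<Rightarrow> nat" where
  "path_length ps = length ps - 1"

end

theory Submission
  imports Defs "HOL-Library.FuncSet"
begin

text \<open>
Induction on \<open>t\<close>: paths for \<open>t + 1\<close> are assembled from about \<open>B / L\<^sup>2\<close> pieces supplied by the case \<open>t\<close>
with \<open>B\<^sup>t\<close> in place of \<open>a\<close>, where \<open>B = a powr (1 / (t + 1))\<close> and \<open>L = 70 log n\<close>. Each piece may consume
more than \<open>B\<^sup>t\<close> rows of the height table, which exceeds the length of the whole path; so the
vertices already used are never a serious obstruction.

To attach a piece to a path ending in \<open>y\<close>, note that an edge of height \<open>h\<close> ending in \<open>v\<close> can be continued
along each of the entries of column \<open>v\<close> in rows below \<open>h\<close>. Colour the vertices with about \<open>log n\<close> colours so
that every relevant window of every column meets each colour in the expected proportion, and let \<open>R i\<close> be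
the set of vertices reached from \<open>y\<close> after \<open>i\<close> steps, the \<open>i\<close>-th step using colour \<open>i - 1\<close> and the \<open>i\<close>-th
window of rows. The sets \<open>R i\<close> cannot double more than \<open>log n\<close> times, so some \<open>R i \<union> R (i + 1)\<close> spans a dense
graph. By counting, its own height table contains an edge of height above \<open>B\<^sup>t\<close>, at which a piece starts;
the colours keep the piece disjoint from the path that leads to it.
\<close>

subsection \<open>Height tables\<close>

definition enter :: "'v set set \<Rightarrow> ('v set \<Rightarrow> nat) \<Rightarrow> 'v set set \<Rightarrow> 'v \<Rightarrow> 'v set set" where
  "enter E w S v = (case pick E w S v of None \<Rightarrow> S | Some f \<Rightarrow> insert f S)"

text \<open>The state of the table with \<open>i\<close> complete rows and the first
  \<open>k\<close> cells of the next one treated. It thus describes row \<open>Suc i\<close>, which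
  explains the shift \<open>i - 1\<close> in \<open>cell\<close> and \<open>column\<close>.\<close>

definition partial_row ::
  "'v::linorder set \<Rightarrow> 'v set set \<Rightarrow> ('v set \<Rightarrow> nat) \<Rightarrow> nat \<Rightarrow> nat \<Rightarrow> 'v set set" where
  "partial_row V E w i k = foldl (enter E w) (entered V E w i) (take k (sorted_list_of_set V))"

lemma ordered_graph_finite:
  assumes "ordered_graph V E w"
  shows "finite V" "finite E"
proof -
  show "finite V" using assms by (simp add: ordered_graph_def simple_graph_def)
  moreover have "E \<subseteq> Pow V"
    using assms by (auto simp: ordered_graph_def simple_graph_def)
  ultimately show "finite E" by (meson finite_Pow_iff finite_subset)
qed

lemma ordered_graph_edgeE:
  assumes "ordered_graph V E w" "e \<in> E"
  obtains x y where "x \<in> V" "y \<in> V" "x \<noteq> y" "e = {x, y}"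
  using assms by (auto simp: ordered_graph_def simple_graph_def)

lemma pick_Some:
  assumes "finite E" "f \<in> E - S" "v \<in> f"
  shows "\<exists>g. pick E w S v = Some g \<and> g \<in> E - S \<and> v \<in> g \<and> w f \<le> w g"
proof -
  define P where "P = (\<lambda>f. f \<in> E - S \<and> v \<in> f)"
  have Pf: "P f" using assms by (simp add: P_def)
  \<comment> \<open>\<open>arg_max\<close> on a natural-valued function is attained only under a
    bound, here supplied by finiteness of \<open>E\<close>.\<close>
  have bd: "\<forall>y. P y \<longrightarrow> w y < Suc (Max (w ` E))"
    using assms(1) by (auto simp: P_def less_Suc_eq_le)
  have "P (arg_max w P)" "w f \<le> w (arg_max w P)"
    using arg_max_natI[of P f w, OF Pf] arg_max_nat_le[of P f w, OF Pf] bd by blast+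
  moreover have "pick E w S v = Some (arg_max w P)"
    using assms by (auto simp: pick_def P_def)
  ultimately show ?thesis by (auto simp: P_def)
qed

lemma pick_SomeD:
  assumes "finite E" "pick E w S v = Some g"
  shows "g \<in> E - S" "v \<in> g"
proof -
  obtain f where "f \<in> E - S" "v \<in> f" using assms(2) by (auto simp: pick_def split: if_splits)
  from pick_Some[OF assms(1) this, of w] assms(2) show "g \<in> E - S" "v \<in> g" by auto
qed

lemma partial_row_0 [simp]: "partial_row V E w i 0 = entered V E w i"
  by (simp add: partial_row_def)

lemma partial_row_Suc:
  assumes "k < card V"
  shows "partial_row V E w i (Suc k) =
    enter E w (partial_row V E w i k) (sorted_list_of_set V ! k)"
  using assms by (simp add: partial_row_def take_Suc_conv_app_nth)

lemma entered_0 [simp]: "entered V E w 0 = {}"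
  by (simp add: entered_def)

lemma entered_Suc: "entered V E w (Suc i) = partial_row V E w i (card V)"
proof -
  have "(\<lambda>S v. case pick E w S v of None \<Rightarrow> S | Some f \<Rightarrow> insert f S) = enter E w"
    by (auto simp: enter_def fun_eq_iff)
  then show ?thesis by (simp add: entered_def partial_row_def row_step_def)
qed

lemma partial_row_mono:
  assumes "k \<le> l" "l \<le> card V"
  shows "partial_row V E w i k \<subseteq> partial_row V E w i l"
  using assms
proof (induction l rule: dec_induct)
  case (step l)
  then show ?case by (auto simp: partial_row_Suc enter_def split: option.split)
qed simp

lemma entered_mono: "i \<le> j \<Longrightarrow> entered V E w i \<subseteq> entered V E w j"
proof (induction j rule: dec_induct)
  case (step j)
  then show ?case using partial_row_mono[of 0 "card V" V E w j] by (auto simp: entered_Suc)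
qed simp

lemma card_entered_le: "finite (entered V E w i) \<and> card (entered V E w i) \<le> i * card V"
proof (induction i)
  case (Suc i)
  have "finite (partial_row V E w i k) \<and> card (partial_row V E w i k) \<le> i * card V + k"
    if "k \<le> card V" for k
    using that
  proof (induction k)
    case (Suc k)
    then show ?case
      by (auto simp: partial_row_Suc enter_def card_insert_if split: option.split)
  qed (use Suc in simp)
  from this[of "card V"] show ?case by (simp add: entered_Suc)
qed simp

text \<open>Entering only adds edges. Since \<open>f\<close> is missing at the end of row
  \<open>Suc i\<close>, it was available when column \<open>v\<close> was treated, so that cell is
  not blank and its entry is at least as large as \<open>f\<close>.\<close>

lemma partial_row_pick:
  assumes "finite E" "v \<in> V" "finite V" "f \<in> E" "v \<in> f" "f \<notin> entered V E w (Suc i)"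
  shows "\<exists>k g. k < card V \<and> sorted_list_of_set V ! k = v \<and>
    pick E w (partial_row V E w i k) v = Some g \<and> g \<in> entered V E w (Suc i) - entered V E w i \<and>
    v \<in> g \<and> g \<in> E \<and> w f \<le> w g"
proof -
  obtain k where k: "k < card V" "sorted_list_of_set V ! k = v"
    using assms(2,3) by (metis in_set_conv_nth set_sorted_list_of_set length_sorted_list_of_set)
  have sub: "partial_row V E w i k \<subseteq> entered V E w (Suc i)"
    using partial_row_mono[of k "card V" V E w i] k(1) by (simp add: entered_Suc)
  have sub0: "entered V E w i \<subseteq> partial_row V E w i k"
    using partial_row_mono[of 0 k V E w i] k(1) by simp
  obtain g where g: "pick E w (partial_row V E w i k) v = Some g"
    "g \<in> E - partial_row V E w i k" "v \<in> g" "w f \<le> w g"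
    using pick_Some[of E f "partial_row V E w i k" v w] sub assms by blast
  have "g \<in> partial_row V E w i (Suc k)"
    using g k by (simp add: partial_row_Suc enter_def)
  then have "g \<in> entered V E w (Suc i)"
    using partial_row_mono[of "Suc k" "card V" V E w i] k(1) by (auto simp: entered_Suc)
  then show ?thesis using k g sub0 by auto
qed

lemma pick_unique_column:
  assumes "finite E" "k < card V" "l < card V"
    "pick E w (partial_row V E w i k) (sorted_list_of_set V ! k) = Some g"
    "pick E w (partial_row V E w i l) (sorted_list_of_set V ! l) = Some g"
  shows "k = l"
proof -
  have False if "k < l" "k < card V" "l < card V"
    "pick E w (partial_row V E w i k) (sorted_list_of_set V ! k) = Some g"
    "pick E w (partial_row V E w i l) (sorted_list_of_set V ! l) = Some g" for k l
  proof -
    have "g \<in> partial_row V E w i (Suc k)"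
      using that by (simp add: partial_row_Suc enter_def)
    then have "g \<in> partial_row V E w i l"
      using partial_row_mono[of "Suc k" l V E w i] that by auto
    then show False using pick_SomeD[OF assms(1) that(5)] by simp
  qed
  then show ?thesis using assms by (metis linorder_neqE_nat)
qed

lemma height_eqI:
  assumes "g \<in> entered V E w (Suc i)" "g \<notin> entered V E w i"
  shows "height V E w g = Suc i"
  unfolding height_def
proof (rule Least_equality)
  fix j assume "g \<in> entered V E w j"
  then show "Suc i \<le> j" using entered_mono[of j i V E w] assms(2) by (meson not_less_eq_eq subsetD)
qed (fact assms)

text \<open>\<open>THE\<close> gives a blank cell an arbitrary value. Facts about cells are drawn
  only from \<open>cell_above\<close>, where an available edge guarantees an entry.\<close>

definition cell :: "'v::linorder set \<Rightarrow> 'v set set \<Rightarrow> ('v set \<Rightarrow> nat) \<Rightarrow> nat \<Rightarrow> 'v \<Rightarrow> 'v set" where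
  "cell V E w i v = (THE g. \<exists>k<card V. sorted_list_of_set V ! k = v \<and>
     pick E w (partial_row V E w (i - 1) k) v = Some g)"

definition column :: "'v::linorder set \<Rightarrow> 'v set set \<Rightarrow> ('v set \<Rightarrow> nat) \<Rightarrow> 'v set \<Rightarrow> 'v" where
  "column V E w g = (THE v. \<exists>k<card V. sorted_list_of_set V ! k = v \<and>
     pick E w (partial_row V E w (height V E w g - 1) k) v = Some g)"

text \<open>Row \<open>i\<close> is filled before \<open>f\<close> is entered, so \<open>f\<close> was still available at both of its endpoints;
the entries chosen there are therefore larger than \<open>f\<close>.\<close>
lemma cell_above:
  assumes "ordered_graph V E w" "f \<in> E" "v \<in> f" "1 \<le> i" "i < height V E w f"
  shows "cell V E w i v \<in> E" "v \<in> cell V E w i v" "column V E w (cell V E w i v) = v"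
    "height V E w (cell V E w i v) = i" "w f < w (cell V E w i v)"
proof -
  note fin = ordered_graph_finite[OF assms(1)]
  obtain j where j: "i = Suc j" using assms(4) by (cases i) auto
  have nin: "f \<notin> entered V E w (Suc j)"
    using assms(5) not_less_Least j unfolding height_def by blast
  have "v \<in> V" using ordered_graph_edgeE[OF assms(1,2)] assms(3) by (metis insertE singletonD)
  then obtain k g where g: "k < card V" "sorted_list_of_set V ! k = v"
    "pick E w (partial_row V E w j k) v = Some g" "g \<in> entered V E w (Suc j) - entered V E w j"
    "v \<in> g" "g \<in> E" "w f \<le> w g"
    using partial_row_pick[OF fin(2) _ fin(1) assms(2,3) nin] by blast
  have h: "height V E w g = Suc j" using height_eqI g(4) by blast
  have cell: "cell V E w i v = g"
    unfolding cell_def j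
  proof (rule the_equality)
    show "\<exists>k<card V. sorted_list_of_set V ! k = v \<and>
      pick E w (partial_row V E w (Suc j - 1) k) v = Some g"
      using g by auto
  next
    fix g' assume "\<exists>k<card V. sorted_list_of_set V ! k = v \<and>
      pick E w (partial_row V E w (Suc j - 1) k) v = Some g'"
    then obtain l where l: "l < card V" "sorted_list_of_set V ! l = v"
      "pick E w (partial_row V E w j l) v = Some g'" by auto
    then have "l = k"
      using g(1,2) nth_eq_iff_index_eq[of "sorted_list_of_set V" l k] by simp
    then show "g' = g" using l(3) g(3) by simp
  qed
  have col: "column V E w g = v"
    unfolding column_def h
  proof (rule the_equality)
    show "\<exists>k<card V. sorted_list_of_set V ! k = v \<and>
      pick E w (partial_row V E w (Suc j - 1) k) v = Some g"
      using g by auto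
  next
    fix x assume "\<exists>k<card V. sorted_list_of_set V ! k = x \<and>
      pick E w (partial_row V E w (Suc j - 1) k) x = Some g"
    then show "x = v" using pick_unique_column[OF fin(2) g(1)] g by auto
  qed
  have "w f \<noteq> w g"
    using assms(1,2) g(4,6) nin by (auto simp: ordered_graph_def inj_on_def)
  then show "cell V E w i v \<in> E" "v \<in> cell V E w i v" "column V E w (cell V E w i v) = v"
    "height V E w (cell V E w i v) = i" "w f < w (cell V E w i v)"
    using g h j cell col by auto
qed

text \<open>The first \<open>m\<close> rows have \<open>m * card V\<close> cells, each holding at
  most one edge, so some edge is entered later.\<close>

lemma exists_height_gt:
  assumes "ordered_graph V E w" "card E > m * card V"
  shows "\<exists>e\<in>E. height V E w e > m"
proof (rule ccontr)
  note fin = ordered_graph_finite[OF assms(1)]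
  assume low: "\<not> ?thesis"
  have "e \<in> entered V E w m" if e: "e \<in> E" for e
  proof -
    \<comment> \<open>The \<open>LEAST\<close> in \<open>height\<close> is meaningful only for an
      edge that is entered at all. An edge never entered would force a new edge of \<open>E\<close>
      into every row, in the column of its endpoint \<open>x\<close>.\<close>
    have "\<exists>i. e \<in> entered V E w i"
    proof (rule ccontr)
      assume never: "\<not> ?thesis"
      obtain x y where x: "x \<in> V" "e = {x, y}" using ordered_graph_edgeE[OF assms(1) e] by metis
      have "i \<le> card (entered V E w i \<inter> E)" for i
      proof (induction i)
        case (Suc i)
        obtain g where "g \<in> entered V E w (Suc i) - entered V E w i" "g \<in> E"
          using partial_row_pick[OF fin(2) x(1) fin(1) e] x never by blast
        then have "entered V E w i \<inter> E \<subset> entered V E w (Suc i) \<inter> E"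
          using entered_mono[of i "Suc i" V E w] by auto
        then have "card (entered V E w i \<inter> E) < card (entered V E w (Suc i) \<inter> E)"
          using fin by (intro psubset_card_mono) auto
        then show ?case using Suc by simp
      qed simp
      from this[of "Suc (card E)"] show False
        using card_mono[OF fin(2), of "entered V E w (Suc (card E)) \<inter> E"] by simp
    qed
    then have "e \<in> entered V E w (height V E w e)" unfolding height_def by (rule LeastI_ex)
    moreover have "height V E w e \<le> m" using low e by auto
    ultimately show ?thesis using entered_mono by blast
  qed
  then have "card E \<le> card (entered V E w m)"
    using card_entered_le by (intro card_mono) blast+
  then show False using card_entered_le[of V E w m] assms(2) by linarith
qed

subsection \<open>Balanced colourings\<close>

text \<open>A first-moment argument. Weight a colouring by \<open>1/2\<close> to the number of
  vertices of \<open>S j\<close> coloured \<open>c j\<close>. In a uniformly random colouring this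
  has mean at most \<open>(1/4) ^ r\<close>. If every colouring failed for some \<open>j\<close>,
  the weights would always sum to at least \<open>(1/2) ^ r\<close> over \<open>J\<close>, which
  needs \<open>card J \<ge> 2 ^ r\<close>.\<close>

lemma balanced_colouring:
  fixes V :: "'v set" and S :: "'j \<Rightarrow> 'v set" and c :: "'j \<Rightarrow> nat"
  assumes fin: "finite V" "finite J" and S: "\<And>j. j \<in> J \<Longrightarrow> S j \<subseteq> V"
    and large: "\<And>j. j \<in> J \<Longrightarrow> card (S j) \<ge> 4 * k * r"
    and c: "\<And>j. j \<in> J \<Longrightarrow> c j < k" and few: "card J < 2 ^ r" and k: "k > 0"
  shows "\<exists>\<chi>. \<forall>j\<in>J. r \<le> card {z \<in> S j. \<chi> z = c j}"
proof (rule ccontr)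
  assume "\<not> ?thesis"
  then have bad: "\<exists>j\<in>J. card {z \<in> S j. \<chi> z = c j} < r" for \<chi> by (meson not_le)
  define F where "F = (V \<rightarrow>\<^sub>E {..<k})"
  define weight where "weight = (\<lambda>j (\<chi>::'v \<Rightarrow> nat). (1/2::real) ^ card {z \<in> S j. \<chi> z = c j})"
  have cardF: "card F = k ^ card V" using fin by (simp add: F_def card_PiE)
  have lower: "(1/2) ^ r \<le> (\<Sum>j\<in>J. weight j \<chi>)" for \<chi>
  proof -
    obtain j where j: "j \<in> J" "card {z \<in> S j. \<chi> z = c j} < r" using bad by blast
    have "(1/2::real) ^ r \<le> weight j \<chi>"
      unfolding weight_def using j by (intro power_decreasing) auto
    also have "\<dots> \<le> (\<Sum>j\<in>J. weight j \<chi>)"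
      using j fin by (intro member_le_sum) (auto simp: weight_def)
    finally show ?thesis .
  qed
  have upper: "(\<Sum>\<chi>\<in>F. weight j \<chi>) \<le> real k ^ card V * (1/4) ^ r" if j: "j \<in> J" for j
  proof -
    have finS: "finite (S j)" using S[OF j] fin finite_subset by blast
    \<comment> \<open>The weight is a product over vertices, so its sum over all colourings is a
      product of one-vertex sums.\<close>
    define f where "f = (\<lambda>z i. if z \<in> S j \<and> i = c j then 1/2 else (1::real))"
    have "weight j \<chi> = (\<Prod>z\<in>V. f z (\<chi> z))" for \<chi>
    proof -
      have "(\<Prod>z\<in>V. f z (\<chi> z)) = (\<Prod>z\<in>{z \<in> S j. \<chi> z = c j}. 1/2)"
        unfolding f_def using S[OF j] fin(1)
        by (intro prod.mono_neutral_cong_right) auto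
      then show ?thesis by (simp add: weight_def)
    qed
    then have "(\<Sum>\<chi>\<in>F. weight j \<chi>) = (\<Sum>\<chi>\<in>F. \<Prod>z\<in>V. f z (\<chi> z))" by simp
    also have "\<dots> = (\<Prod>z\<in>V. \<Sum>i<k. f z i)"
      unfolding F_def using fin by (simp add: prod_sum_PiE)
    also have "\<dots> = (\<Prod>z\<in>V. real k * (if z \<in> S j then 1 - 1 / (2 * real k) else 1))"
    proof (rule prod.cong)
      fix z assume "z \<in> V"
      have "(\<Sum>i<k. f z i) = (\<Sum>i<k. 1 - (if z \<in> S j \<and> i = c j then 1/2 else 0))"
        by (intro sum.cong) (auto simp: f_def)
      also have "\<dots> = real k - (if z \<in> S j then 1/2 else 0)"
        using c[OF j] by (simp add: sum_subtractf)
      also have "\<dots> = real k * (if z \<in> S j then 1 - 1 / (2 * real k) else 1)"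
        using k by (simp add: field_simps)
      finally show "(\<Sum>i<k. f z i) = \<dots>" .
    qed simp
    also have "\<dots> = real k ^ card V * (\<Prod>z\<in>V. if z \<in> S j then 1 - 1 / (2 * real k) else 1)"
      by (simp add: prod.distrib)
    also have "(\<Prod>z\<in>V. if z \<in> S j then 1 - 1 / (2 * real k) else 1) =
        (1 - 1 / (2 * real k)) ^ card (S j)"
    proof -
      have "(\<Prod>z\<in>V. if z \<in> S j then 1 - 1 / (2 * real k) else 1) =
          (\<Prod>z\<in>S j. 1 - 1 / (2 * real k))"
        using S[OF j] fin(1) by (intro prod.mono_neutral_cong_right) auto
      then show ?thesis by simp
    qed
    \<comment> \<open>The factor 4 in the size of \<open>S j\<close> brings the mean down to
      \<open>exp (- 2) ^ r\<close>, and \<open>exp 2 \<ge> 4\<close>.\<close>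
    also have "(1 - 1 / (2 * real k)) ^ card (S j) \<le> (1 - 1 / (2 * real k)) ^ (4 * k * r)"
      using large[OF j] k by (intro power_decreasing) auto
    also have "(1 - 1 / (2 * real k)) ^ (4 * k * r) \<le> exp (- (1 / (2 * real k))) ^ (4 * k * r)"
      using k exp_ge_add_one_self[of "- (1 / (2 * real k))"] by (intro power_mono) auto
    also have "exp (- (1 / (2 * real k))) ^ (4 * k * r) = exp (- 2) ^ r"
      using k by (simp add: exp_of_nat_mult[symmetric])
    also have "exp (- 2 :: real) ^ r \<le> (1/4) ^ r"
    proof (rule power_mono)
      have "(2::real)\<^sup>2 \<le> exp 1 ^ 2" using exp_ge_add_one_self[of 1] by (intro power_mono) auto
      then have "4 \<le> exp (2::real)" by (simp add: exp_of_nat_mult[symmetric])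
      then show "exp (- 2 :: real) \<le> 1/4" by (simp add: exp_minus field_simps)
    qed simp
    finally show ?thesis by (simp add: mult_left_mono)
  qed
  have "real (k ^ card V) * (1/2) ^ r = (\<Sum>\<chi>\<in>F. (1/2) ^ r)" by (simp add: cardF)
  also have "\<dots> \<le> (\<Sum>\<chi>\<in>F. \<Sum>j\<in>J. weight j \<chi>)" by (intro sum_mono lower)
  also have "\<dots> = (\<Sum>j\<in>J. \<Sum>\<chi>\<in>F. weight j \<chi>)" by (rule sum.swap)
  also have "\<dots> \<le> (\<Sum>j\<in>J. real k ^ card V * (1/4) ^ r)" by (intro sum_mono upper)
  also have "\<dots> = real k ^ card V * (real (card J) * (1/4) ^ r)" by simp
  finally have "(1/2) ^ r \<le> real (card J) * (1/4) ^ r" using k by simp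
  moreover have "(1/4::real) ^ r = (1/2) ^ r * (1/2) ^ r" by (simp add: power_mult_distrib[symmetric])
  ultimately have "1 \<le> real (card J) * (1/2) ^ r" by simp
  then have "2 ^ r \<le> real (card J)" by (simp add: power_divide field_simps)
  also have "\<dots> < 2 ^ r" using few by (metis of_nat_less_iff of_nat_numeral of_nat_power)
  finally show False by simp
qed

subsection \<open>Concatenation of increasing paths\<close>

abbreviation last_edge :: "'v list \<Rightarrow> 'v set" where
  "last_edge ps \<equiv> {ps ! (length ps - 2), ps ! (length ps - 1)}"

text \<open>The shared vertex is kept once, hence \<open>tl P\<close> and disjointness from
  \<open>butlast Q\<close> only. The one inequality not inherited from \<open>Q\<close> or
  \<open>P\<close> is that across the junction.\<close>

lemma increasing_path_glue:
  assumes Q: "increasing_path E w Q" and P: "increasing_path E w P"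
    and junction: "last Q = hd P" "w (last_edge Q) < w {P ! 0, P ! 1}"
    and disj: "set (butlast Q) \<inter> set P = {}"
  shows "increasing_path E w (Q @ tl P)"
    "{(Q @ tl P) ! 0, (Q @ tl P) ! 1} = {Q ! 0, Q ! 1}"
    "path_length (Q @ tl P) = path_length Q + path_length P"
    "path_edges (Q @ tl P) \<subseteq> path_edges Q \<union> path_edges P"
proof -
  let ?R = "Q @ tl P"
  define m where "m = length Q"
  have m: "m \<ge> 2" and lP: "length P \<ge> 2" using Q P by (auto simp: increasing_path_def m_def)
  have "Q \<noteq> []" using m by (auto simp: m_def)
  have left: "?R ! j = Q ! j" if "j < m" for j using that by (simp add: nth_append m_def)
  \<comment> \<open>Since \<open>last Q = hd P\<close>, position \<open>m - 1\<close> belongs to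
    both paths, and the offset of \<open>P\<close> is \<open>m - 1\<close> rather than
    \<open>m\<close>.\<close>
  have right: "?R ! j = P ! (j - (m - 1))" if "m - 1 \<le> j" "j < length ?R" for j
  proof (cases "j = m - 1")
    case True
    then have "?R ! j = last Q" using left[of j] m \<open>Q \<noteq> []\<close> by (simp add: last_conv_nth m_def)
    then show ?thesis using True junction(1) lP by (cases P) auto
  next
    case False
    then have "?R ! j = tl P ! (j - m)" using that m by (auto simp: nth_append m_def)
    also have "\<dots> = P ! Suc (j - m)" using that False lP by (intro nth_tl) (auto simp: m_def)
    also have "Suc (j - m) = j - (m - 1)" using that False m by simp
    finally show ?thesis .
  qed
  have lR: "length ?R = m + length P - 1" using lP by (simp add: m_def)
  have "Q = butlast Q @ [hd P]"
    using \<open>Q \<noteq> []\<close> junction(1) append_butlast_last_id[of Q] by simp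
  then have eq: "?R = butlast Q @ P" using lP by (cases P) auto
  show "increasing_path E w ?R"
    unfolding increasing_path_def
  proof (intro conjI allI impI)
    show "2 \<le> length ?R" using m by (simp add: m_def)
    show "distinct ?R"
      using Q P disj unfolding eq by (auto simp: increasing_path_def distinct_butlast)
  next
    fix k assume k: "k + 1 < length ?R"
    show "{?R ! k, ?R ! (k + 1)} \<in> E"
    proof (cases "k + 1 < m")
      case True
      then show ?thesis using Q left[of k] left[of "k+1"] by (auto simp: increasing_path_def m_def)
    next
      case False
      have "k + 1 - (m - 1) = k - (m - 1) + 1" using False m by simp
      then show ?thesis using False P right[of k] right[of "k+1"] k lR m
        by (auto simp: increasing_path_def)
    qed
  next
    fix k assume k: "k + 2 < length ?R"
    consider "k + 2 < m" | "k + 2 = m" | "k + 1 \<ge> m" by linarith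
    then show "w {?R ! k, ?R ! (k + 1)} < w {?R ! (k + 1), ?R ! (k + 2)}"
    proof cases
      case 1
      then show ?thesis using Q left[of k] left[of "k+1"] left[of "k+2"]
        by (auto simp: increasing_path_def m_def)
    next
      case 2
      then have "k = m - 2" "k + 1 = m - 1" "k + 1 - (m - 1) = 0" "k + 2 - (m - 1) = 1" by auto
      then have "{?R ! k, ?R ! (k + 1)} = last_edge Q" "{?R ! (k + 1), ?R ! (k + 2)} = {P ! 0, P ! 1}"
        using left[of k] left[of "k+1"] right[of "k+1"] right[of "k+2"] k m by (auto simp: m_def)
      then show ?thesis using junction(2) by simp
    next
      case 3
      have "k + 1 - (m - 1) = k - (m - 1) + 1" "k + 2 - (m - 1) = k - (m - 1) + 2"
        using 3 m by auto
      then show ?thesis using 3 P right[of k] right[of "k+1"] right[of "k+2"] k lR m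
        by (auto simp: increasing_path_def)
    qed
  qed
  show "{?R ! 0, ?R ! 1} = {Q ! 0, Q ! 1}" using left[of 0] left[of 1] m by simp
  show "path_length ?R = path_length Q + path_length P"
    using lR m lP by (simp add: path_length_def m_def)
  show "path_edges ?R \<subseteq> path_edges Q \<union> path_edges P"
  proof
    fix f assume "f \<in> path_edges ?R"
    then obtain k where k: "k + 1 < length ?R" "f = {?R ! k, ?R ! (k + 1)}"
      by (auto simp: path_edges_def)
    show "f \<in> path_edges Q \<union> path_edges P"
    proof (cases "k + 1 < m")
      case True
      then have "f = {Q ! k, Q ! (k + 1)}" using k left[of k] left[of "k+1"] by simp
      then show ?thesis using True by (auto simp: path_edges_def m_def)
    next
      case False
      have "k + 1 - (m - 1) = k - (m - 1) + 1" using False m by simp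
      then have "f = {P ! (k - (m - 1)), P ! (k - (m - 1) + 1)}"
        using False right[of k] right[of "k+1"] k m by auto
      moreover have "k - (m - 1) + 1 < length P" using k lR False m by simp
      ultimately show ?thesis by (auto simp: path_edges_def)
    qed
  qed
qed

section \<open>Edge sets and tails of increasing paths\<close>

lemma increasing_path_mono: "increasing_path E w P \<Longrightarrow> E \<subseteq> F \<Longrightarrow> increasing_path F w P"
  by (auto simp: increasing_path_def)

lemma path_edges_subset: "increasing_path E w P \<Longrightarrow> path_edges P \<subseteq> E"
  by (auto simp: increasing_path_def path_edges_def)

lemma last_edge_in_path_edges: "increasing_path E w P \<Longrightarrow> last_edge P \<in> path_edges P"
  unfolding increasing_path_def path_edges_def
  by (rule CollectI, rule exI[of _ "length P - 2"]) (auto simp: numeral_2_eq_2 Suc_diff_Suc)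

lemma last_in_last_edge: "increasing_path E w P \<Longrightarrow> last P \<in> last_edge P"
  by (cases P) (auto simp: increasing_path_def last_conv_nth)

lemma set_subset_Union_path_edges:
  assumes "increasing_path E w P"
  shows "set P \<subseteq> \<Union> (path_edges P)"
proof
  fix x assume "x \<in> set P"
  then obtain k where k: "k < length P" "x = P ! k" by (metis in_set_conv_nth)
  show "x \<in> \<Union> (path_edges P)"
  proof (cases "k + 1 < length P")
    case True
    then show ?thesis using k by (auto simp: path_edges_def)
  next
    case False
    then have "x = last P" using k by (cases P) (auto simp: last_conv_nth less_Suc_eq)
    then show ?thesis using assms last_edge_in_path_edges last_in_last_edge by blast
  qed
qed

text \<open>Used when the first edge of a path has to be skipped: the next edge is larger still, so
  it also exceeds everything below the skipped one.\<close>

lemma increasing_path_tl: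
  assumes "increasing_path E w P" "length P > 2"
  shows "increasing_path E w (tl P)" "w {P ! 0, P ! 1} < w {tl P ! 0, tl P ! 1}"
    "path_length (tl P) = path_length P - 1" "path_edges (tl P) \<subseteq> path_edges P"
proof -
  have nth: "tl P ! k = P ! (k + 1)" if "k < length P - 1" for k
    using that by (simp add: nth_tl)
  have e: "k + 1 < length P - 1 \<Longrightarrow> {P ! (k + 1), P ! (k + 1 + 1)} \<in> E"
    "k + 2 < length P - 1 \<Longrightarrow> w {P ! (k+1), P ! (k + 1 + 1)} < w {P ! (k + 1 + 1), P ! (k + 1 + 2)}" for k
    using assms(1) by (auto simp: increasing_path_def dest: spec[of _ "k + 1"])
  show "increasing_path E w (tl P)"
    unfolding increasing_path_def
  proof (intro conjI allI impI)
    fix k assume "k + 1 < length (tl P)"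
    then show "{tl P ! k, tl P ! (k + 1)} \<in> E" using e(1)[of k] nth[of k] nth[of "k+1"] by simp
  next
    fix k assume "k + 2 < length (tl P)"
    then show "w {tl P ! k, tl P ! (k + 1)} < w {tl P ! (k + 1), tl P ! (k + 2)}"
      using e(2)[of k] nth[of k] nth[of "k+1"] nth[of "k+2"] by simp
  qed (use assms in \<open>auto simp: increasing_path_def distinct_tl\<close>)
  have "w {P ! 0, P ! (0+1)} < w {P ! (0+1), P ! (0+2)}"
    using assms unfolding increasing_path_def by (metis add_0)
  then show "w {P ! 0, P ! 1} < w {tl P ! 0, tl P ! 1}"
    using nth[of 0] nth[of 1] assms(2) by (simp add: numeral_2_eq_2)
  show "path_length (tl P) = path_length P - 1" by (simp add: path_length_def)
  show "path_edges (tl P) \<subseteq> path_edges P"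
  proof
    fix f assume "f \<in> path_edges (tl P)"
    then obtain k where k: "k + 1 < length P - 1" "f = {tl P ! k, tl P ! (k + 1)}"
      by (auto simp: path_edges_def)
    then have "f = {P ! (k + 1), P ! (k + 1 + 1)}" using nth[of k] nth[of "k+1"] by simp
    then show "f \<in> path_edges P" using k(1) unfolding path_edges_def by (intro CollectI exI[of _ "k+1"]) auto
  qed
qed

lemma increasing_path_edge:
  assumes "{x, y} \<in> E" "x \<noteq> y"
  shows "increasing_path E w [x, y]" "path_edges [x, y] = {{x, y}}" "path_length [x, y] = 1"
  using assms by (auto simp: increasing_path_def path_edges_def path_length_def)

text \<open>The path \<open>P\<close> may traverse its first edge towards \<open>last Q\<close>; then that edge is skipped.\<close>
lemma increasing_path_attach:
  assumes Q: "increasing_path E w Q" and P: "increasing_path E w P"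
    and start: "last Q \<in> {P ! 0, P ! 1}" "w (last_edge Q) < w {P ! 0, P ! 1}"
    and disj: "set (butlast Q) \<inter> set P = {}"
  shows "\<exists>R. increasing_path E w R \<and> {R ! 0, R ! 1} = {Q ! 0, Q ! 1} \<and>
    path_length R \<ge> path_length Q + path_length P - 1 \<and> path_edges R \<subseteq> path_edges Q \<union> path_edges P"
proof -
  have lP: "length P \<ge> 2" using P by (simp add: increasing_path_def)
  consider "last Q = P ! 0" | "last Q = P ! 1" "length P = 2" | "last Q = P ! 1" "length P > 2"
    using start(1) lP by fastforce
  then show ?thesis
  proof cases
    case 1
    then have "last Q = hd P" using lP by (cases P) auto
    from increasing_path_glue[OF Q P this start(2) disj] show ?thesis
      by (intro exI[of _ "Q @ tl P"]) auto
  next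
    case 2
    then show ?thesis using Q by (intro exI[of _ Q]) (auto simp: path_length_def)
  next
    case 3
    note t = increasing_path_tl[OF P 3(2)]
    have "last Q = hd (tl P)" using 3 by (cases P; cases "tl P") auto
    moreover have "w (last_edge Q) < w {tl P ! 0, tl P ! 1}" using start(2) t(2) by simp
    moreover have "set (butlast Q) \<inter> set (tl P) = {}" using disj by (cases P) auto
    ultimately show ?thesis
      using increasing_path_glue[OF Q t(1)] t(3,4) lP
      by (intro exI[of _ "Q @ tl (tl P)"]) (auto simp: path_length_def)
  qed
qed

subsection \<open>Extension by one piece\<close>

text \<open>More than doubling at each of the levels 1 to \<open>K\<close>, starting from at least
  one vertex, would push \<open>R (Suc K)\<close> beyond \<open>2 ^ K\<close>.\<close>

lemma exists_nonexpanding_level: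
  fixes R :: "nat \<Rightarrow> 'v set"
  assumes "card (R 1) \<ge> 1" "K \<ge> 1" "card (R (Suc K)) \<le> 2 ^ K"
  shows "\<exists>i\<ge>1. i \<le> K \<and> card (R (Suc i)) \<le> 2 * card (R i)"
proof (rule ccontr)
  assume "\<not> ?thesis"
  then have exp: "card (R (Suc i)) > 2 * card (R i)" if "1 \<le> i" "i \<le> K" for i
    using that by (meson not_le)
  have "card (R (Suc i)) \<ge> 2 ^ i" if "i \<le> K" for i
    using that
  proof (induction i)
    case (Suc i)
    then show ?case using exp[of "Suc i"] by simp
  qed (use assms in simp)
  from this[of "K - 1"] have "2 ^ (K - 1) \<le> card (R K)" using assms(2) by simp
  moreover have "(2::nat) ^ K = 2 * 2 ^ (K - 1)"
    using assms(2) by (metis Suc_diff_1 less_eq_Suc_le One_nat_def power_Suc)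
  ultimately show False using exp[of K] assms by linarith
qed

text \<open>One round of the assembly, with the induction hypothesis abstracted to
  \<open>sub\<close>. Heights in \<open>sub\<close> refer to the subgraph's own table, whereas the
  cost is measured in the original one: at most \<open>K\<close> windows of \<open>d\<close> rows to
  reach a dense level, and one more for the piece.\<close>

lemma extend_increasing_path:
  fixes V :: "'v::linorder set"
  assumes G: "ordered_graph V E w" and V2: "card V \<ge> 2" and K: "card V \<le> 2 ^ K"
    and r: "card V * Suc K < 2 ^ r" "r > 3 * m"
    and sub: "\<And>V' E' f. \<lbrakk>V' \<subseteq> V; E' \<subseteq> E; ordered_graph V' E' w; f \<in> E'; height V' E' w f > m\<rbrakk>
      \<Longrightarrow> \<exists>P. increasing_path E' w P \<and> {P ! 0, P ! 1} = f \<and> path_length P \<ge> p"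
    and ps: "increasing_path E w ps" and hps: "\<And>f. f \<in> path_edges ps \<Longrightarrow> height V E w f \<ge> h"
    and d: "d \<ge> 4 * Suc K * r + length ps" and h: "h > Suc K * d"
  shows "\<exists>R. increasing_path E w R \<and> {R ! 0, R ! 1} = {ps ! 0, ps ! 1} \<and>
    path_length R \<ge> path_length ps + p \<and> (\<forall>f\<in>path_edges R. height V E w f \<ge> h - Suc K * d)"
proof -
  note fin = ordered_graph_finite[OF G]
  let ?cell = "cell V E w"
  \<comment> \<open>\<open>T v i\<close> collects the neighbours off \<open>ps\<close> that the
    \<open>i\<close>-th window of column \<open>v\<close> offers. \<open>J\<close> keeps the pairs
    with enough of them for the colouring lemma, as columns that are not reached may be mostly blank
    there.\<close>
  define T where "T = (\<lambda>v i. {z \<in> V - set ps. \<exists>j. h - Suc i * d \<le> j \<and> j < h - i * d \<and> ?cell j v = {v, z}})"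
  define J where "J = {(v, i). v \<in> V \<and> i \<le> K \<and> card (T v i) \<ge> 4 * Suc K * r}"
  have J_sub: "J \<subseteq> V \<times> {..K}" by (auto simp: J_def)
  have "card J \<le> card (V \<times> {..K})" using fin by (intro card_mono J_sub) auto
  then have card_J: "card J < 2 ^ r" using r by (simp add: card_cartesian_product)
  have T_sub: "T v i \<subseteq> V" for v i by (auto simp: T_def)
  have "\<exists>\<chi>. \<forall>j\<in>J. r \<le> card {z \<in> case j of (v, i) \<Rightarrow> T v i. \<chi> z = snd j}"
  proof (rule balanced_colouring)
    show "finite V" "finite J" using fin J_sub finite_subset by auto
  qed (use card_J T_sub in \<open>auto simp: J_def\<close>)
  then obtain \<chi> where \<chi>: "\<And>v i. (v, i) \<in> J \<Longrightarrow> r \<le> card {z \<in> T v i. \<chi> z = i}"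
    by fastforce
  define N where "N = (\<lambda>v i. {z \<in> T v i. \<chi> z = i})"
  define R where "R = rec_nat {last ps} (\<lambda>i X. \<Union>v\<in>X. N v i)"
  have R_0: "R 0 = {last ps}" and R_Suc: "R (Suc i) = (\<Union>v\<in>R i. N v i)" for i
    by (simp_all add: R_def)
  have colour: "\<chi> v = i \<and> v \<notin> set ps \<and> v \<in> V" if "v \<in> R (Suc i)" for v i
    using that by (auto simp: R_Suc N_def T_def)
  \<comment> \<open>\<open>h > Suc K * d\<close> keeps all windows inside the rows from 1 on, so
    that \<open>cell_above\<close> applies.\<close>
  have row: "1 \<le> j \<and> j < hf" if "h - Suc i * d \<le> j" "j < h - i * d" "i \<le> K" "hf \<ge> h - i * d" for i j hf
  proof -
    have "Suc i * d \<le> Suc K * d" using that(3) by (intro mult_le_mono1) simp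
    then show ?thesis using that h by linarith
  qed
  have N_edge: "{v, z} \<in> E \<and> w f < w {v, z} \<and> column V E w {v, z} = v \<and> height V E w {v, z} \<ge> h - Suc i * d"
    if "f \<in> E" "v \<in> f" "height V E w f \<ge> h - i * d" "i \<le> K" "z \<in> N v i" for f v i z
  proof -
    obtain j where j: "h - Suc i * d \<le> j" "j < h - i * d" "?cell j v = {v, z}"
      using \<open>z \<in> N v i\<close> by (auto simp: N_def T_def)
    then have "1 \<le> j" "j < height V E w f" using row[OF j(1,2) that(4,3)] by auto
    from cell_above[OF G that(1,2) this] j show ?thesis by simp
  qed
  have N_large: "card (N v i) \<ge> r"
    if f: "f \<in> E" "v \<in> f" "height V E w f \<ge> h - i * d" "i \<le> K" for f v i
  proof -
    have v: "v \<in> V" using ordered_graph_edgeE[OF G f(1)] f(2) by (metis insertE singletonD)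
    let ?I = "{h - Suc i * d..<h - i * d}"
    have cl: "?cell j v \<in> E" "v \<in> ?cell j v" "height V E w (?cell j v) = j" if "j \<in> ?I" for j
      using cell_above[OF G f(1,2)] row[of i j, OF _ _ f(4,3)] that by auto
    have "\<exists>z. ?cell j v = {v, z} \<and> z \<in> V" if j: "j \<in> ?I" for j
    proof -
      obtain x y where "x \<in> V" "y \<in> V" "?cell j v = {x, y}"
        using ordered_graph_edgeE[OF G cl(1)[OF j]] by metis
      then show ?thesis using cl(2)[OF j] by (cases "v = x") auto
    qed
    then obtain g where g: "\<And>j. j \<in> ?I \<Longrightarrow> ?cell j v = {v, g j} \<and> g j \<in> V" by metis
    \<comment> \<open>\<open>g j\<close> determines the entry \<open>{v, g j}\<close> and thereby
      its row \<open>j\<close>, so \<open>d\<close> rows offer \<open>d\<close> distinct neighbours.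
      At least \<open>4 * Suc K * r\<close> of them lie off \<open>ps\<close>.\<close>
    have "inj_on g ?I" by (rule inj_onI) (metis cl(3) g)
    then have "card (g ` ?I) = card ?I" by (rule card_image)
    also have "\<dots> = d"
    proof -
      have "Suc i * d \<le> Suc K * d" using f(4) by (intro mult_le_mono1) simp
      then have "Suc i * d < h" using h by linarith
      moreover have "Suc i * d = i * d + d" by simp
      ultimately show ?thesis unfolding card_atLeastLessThan by linarith
    qed
    finally have "d - length ps \<le> card (g ` ?I - set ps)"
      using diff_card_le_card_Diff[of "set ps" "g ` ?I"] card_length[of ps] by simp
    also have "\<dots> \<le> card (T v i)"
      using g fin T_sub finite_subset[OF T_sub] by (intro card_mono) (auto simp: T_def)
    finally have "(v, i) \<in> J" using d v f(4) by (auto simp: J_def)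
    then show ?thesis using \<chi> by (simp add: N_def)
  qed
  \<comment> \<open>A vertex of level \<open>s \<ge> 1\<close> has colour \<open>s - 1\<close> and
    lies off \<open>ps\<close>. The last condition therefore confines the vertices before
    \<open>v\<close> to \<open>ps\<close> and the colours of lower levels, so the next vertex is
    always new.\<close>
  have reach: "\<exists>Q. increasing_path E w Q \<and> {Q ! 0, Q ! 1} = {ps ! 0, ps ! 1} \<and> last Q = v \<and>
      path_length Q = path_length ps + i \<and> (\<forall>f\<in>path_edges Q. height V E w f \<ge> h - i * d) \<and>
      set (butlast Q) \<subseteq> set ps \<union> {z. Suc (\<chi> z) < i}"
    if "v \<in> R i" "i \<le> Suc K" for v i
    using that
  proof (induction i arbitrary: v)
    case 0
    then show ?case using ps hps by (intro exI[of _ ps]) (auto simp: R_0 dest: in_set_butlastD)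
  next
    case (Suc i)
    then obtain u where u: "u \<in> R i" "v \<in> N u i" by (auto simp: R_Suc)
    then obtain Q where Q: "increasing_path E w Q" "{Q ! 0, Q ! 1} = {ps ! 0, ps ! 1}" "last Q = u"
      "path_length Q = path_length ps + i" "\<And>f. f \<in> path_edges Q \<Longrightarrow> height V E w f \<ge> h - i * d"
      "set (butlast Q) \<subseteq> set ps \<union> {z. Suc (\<chi> z) < i}"
      using Suc by (metis Suc_leD)
    have le: "last_edge Q \<in> E" "u \<in> last_edge Q" "height V E w (last_edge Q) \<ge> h - i * d"
      using path_edges_subset[OF Q(1)] last_edge_in_path_edges[OF Q(1)] last_in_last_edge[OF Q(1)] Q(3,5)
      by auto
    note e = N_edge[OF le _ u(2)]
    have uv: "u \<noteq> v" using e Suc.prems(2) G by (auto elim: ordered_graph_edgeE)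
    have e': "{u, v} \<in> E" using e Suc.prems(2) by auto
    note s = increasing_path_edge[OF e' uv]
    have v: "\<chi> v = i" "v \<notin> set ps" using colour[OF Suc.prems(1)] by auto
    have u': "u \<in> set ps \<union> {z. Suc (\<chi> z) = i}"
    proof (cases i)
      case 0
      moreover have "ps \<noteq> []" using ps by (auto simp: increasing_path_def)
      ultimately show ?thesis using u(1) by (simp add: R_0)
    next
      case (Suc i')
      then show ?thesis using colour u(1) by auto
    qed
    have "Q \<noteq> []" using Q(1) by (auto simp: increasing_path_def)
    then have Q_eq: "Q = butlast Q @ [u]" using Q(3) append_butlast_last_id by metis
    have "distinct Q" using Q(1) by (simp add: increasing_path_def)
    then have "u \<notin> set (butlast Q)" by (subst (asm) Q_eq) simp
    then have disj: "set (butlast Q) \<inter> set [u, v] = {}" using Q(6) v by auto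
    have "set Q = insert u (set (butlast Q))" by (subst Q_eq) simp
    then have sQ: "set Q \<subseteq> set ps \<union> {z. Suc (\<chi> z) < Suc i}" using Q(6) u' by auto
    have "w (last_edge Q) < w {[u, v] ! 0, [u, v] ! 1}" using e Suc.prems(2) by simp
    from increasing_path_glue[OF Q(1) s(1) _ this disj] Q(2,3,4,5) s e Suc.prems(2) sQ
    show ?case
      by (intro exI[of _ "Q @ [v]"]) (fastforce simp: butlast_append)
  qed
  have R_edge: "\<exists>f\<in>E. v \<in> f \<and> height V E w f \<ge> h - i * d" if vi: "v \<in> R i" "i \<le> K" for v i
  proof -
    obtain Q where Q: "increasing_path E w Q" "last Q = v"
      "\<forall>f\<in>path_edges Q. height V E w f \<ge> h - i * d"
      using reach[OF vi(1) le_SucI[OF vi(2)]] by blast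
    then have "last_edge Q \<in> path_edges Q" "v \<in> last_edge Q" "path_edges Q \<subseteq> E"
      using last_edge_in_path_edges last_in_last_edge path_edges_subset by blast+
    then show ?thesis using Q(3) by blast
  qed
  have R_V: "R i \<subseteq> V" for i
  proof (cases i)
    case 0
    have "last ps \<in> last_edge ps" "last_edge ps \<in> E"
      using ps last_in_last_edge last_edge_in_path_edges path_edges_subset by blast+
    then have "last ps \<in> V" by (metis G ordered_graph_edgeE insertE singletonD)
    then show ?thesis using 0 by (simp add: R_0)
  qed (use colour in blast)
  have finR: "finite (R i)" for i using R_V fin finite_subset by blast
  have K1: "K \<ge> 1" using V2 K by (cases K) auto
  have R_ne: "R i \<noteq> {}" if "i \<le> Suc K" for i
    using that
  proof (induction i)
    case (Suc i)
    then obtain v where v: "v \<in> R i" by auto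
    then obtain f where "f \<in> E" "v \<in> f" "height V E w f \<ge> h - i * d" using R_edge Suc.prems by fastforce
    from N_large[OF this] have "N v i \<noteq> {}" using r Suc.prems by auto
    then show ?case using v by (auto simp: R_Suc)
  qed (simp add: R_0)
  have "\<exists>i\<ge>1. i \<le> K \<and> card (R (Suc i)) \<le> 2 * card (R i)"
  proof (rule exists_nonexpanding_level)
    show "card (R 1) \<ge> 1" using finR[of 1] R_ne[of 1] by (simp add: Suc_le_eq card_gt_0_iff)
    show "card (R (Suc K)) \<le> 2 ^ K" using card_mono[OF fin(1) R_V] K le_trans by blast
  qed (fact K1)
  then obtain i where i: "i \<ge> 1" "i \<le> K" "card (R (Suc i)) \<le> 2 * card (R i)" by blast
  define V' where "V' = R i \<union> R (Suc i)"
  define E' where "E' = (\<lambda>(x, z). {x, z}) ` (SIGMA x:R i. N x i)"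
  have E'_edge: "{x, z} \<in> E \<and> column V E w {x, z} = x \<and> height V E w {x, z} \<ge> h - Suc i * d"
    if "x \<in> R i" "z \<in> N x i" for x z
    using R_edge[OF that(1) i(2)] N_edge i(2) that(2) by blast
  have "E' \<subseteq> E" using E'_edge by (auto simp: E'_def)
  have "card (R i) > 0" using R_ne i finR by (simp add: card_gt_0_iff)
  have G': "ordered_graph V' E' w"
    unfolding ordered_graph_def simple_graph_def
  proof (intro conjI ballI)
    show "finite V'" using finR by (simp add: V'_def)
    show "inj_on w E'" using G \<open>E' \<subseteq> E\<close> by (auto simp: ordered_graph_def intro: inj_on_subset)
  next
    fix e assume "e \<in> E'"
    then obtain x z where xz: "x \<in> R i" "z \<in> N x i" "e = {x, z}" by (auto simp: E'_def)
    then have "x \<noteq> z" using E'_edge[OF xz(1,2)] G by (auto elim: ordered_graph_edgeE)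
    moreover have "z \<in> R (Suc i)" using xz by (auto simp: R_Suc)
    ultimately show "\<exists>x y. x \<in> V' \<and> y \<in> V' \<and> x \<noteq> y \<and> e = {x, y}" using xz by (auto simp: V'_def)
  qed
  \<comment> \<open>Each vertex of \<open>R i\<close> contributes at least \<open>r > 3 * m\<close>
    edges, and \<open>V'\<close> has at most \<open>3 * card (R i)\<close> vertices because level
    \<open>i\<close> does not more than double.\<close>
  have "card E' > m * card V'"
  proof -
    have "inj_on (\<lambda>(x, z). {x, z}) (SIGMA x:R i. N x i)"
    proof (rule inj_onI, clarify)
      fix x z x' z' assume *: "x \<in> R i" "z \<in> N x i" "x' \<in> R i" "z' \<in> N x' i" "{x, z} = {x', z'}"
      \<comment> \<open>The column of \<open>{x, z}\<close> is \<open>x\<close>, so no edge is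
        counted from both ends.\<close>
      then have "x = x'" using E'_edge by metis
      then show "x = x' \<and> z = z'" using *(5) by (auto simp: doubleton_eq_iff)
    qed
    then have "card E' = card (SIGMA x:R i. N x i)" unfolding E'_def by (rule card_image)
    also have "\<dots> = (\<Sum>x\<in>R i. card (N x i))"
      using finR fin(1) finite_subset[OF T_sub] by (intro card_SigmaI) (auto simp: N_def)
    also have "\<dots> \<ge> (\<Sum>x\<in>R i. r)"
      using R_edge N_large i(2) by (intro sum_mono) blast
    finally have "card (R i) * r \<le> card E'" by simp
    moreover have "card (R i) * (3 * m) < card (R i) * r" using r \<open>card (R i) > 0\<close> by simp
    moreover have "card V' \<le> 3 * card (R i)"
      using card_Un_le[of "R i" "R (Suc i)"] i(3) by (simp add: V'_def)
    then have "m * card V' \<le> card (R i) * (3 * m)" by (metis mult.assoc mult.commute mult_le_mono2)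
    ultimately show ?thesis by linarith
  qed
  from exists_height_gt[OF G' this] obtain f where f: "f \<in> E'" "height V' E' w f > m" by blast
  have "V' \<subseteq> V" using R_V by (simp add: V'_def)
  from sub[OF this \<open>E' \<subseteq> E\<close> G' f] obtain P where
    P: "increasing_path E' w P" "{P ! 0, P ! 1} = f" "path_length P \<ge> p" by blast
  obtain x z where xz: "x \<in> R i" "z \<in> N x i" "f = {x, z}" using f(1) by (auto simp: E'_def)
  obtain Q where Q: "increasing_path E w Q" "{Q ! 0, Q ! 1} = {ps ! 0, ps ! 1}" "last Q = x"
    "path_length Q = path_length ps + i" "\<And>f. f \<in> path_edges Q \<Longrightarrow> height V E w f \<ge> h - i * d"
    "set (butlast Q) \<subseteq> set ps \<union> {z. Suc (\<chi> z) < i}"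
    using reach[OF xz(1) le_SucI[OF i(2)]] by blast
  have le: "last_edge Q \<in> E" "x \<in> last_edge Q" "height V E w (last_edge Q) \<ge> h - i * d"
    using path_edges_subset[OF Q(1)] last_edge_in_path_edges[OF Q(1)] last_in_last_edge[OF Q(1)] Q(3,5)
    by auto
  have "set P \<subseteq> \<Union> E'" using set_subset_Union_path_edges[OF P(1)] path_edges_subset[OF P(1)] by blast
  also have "\<dots> \<subseteq> V'" using G' by (auto elim!: ordered_graph_edgeE)
  finally have "set P \<subseteq> V'" .
  \<comment> \<open>As \<open>i \<ge> 1\<close>, the level \<open>R 0\<close>, which meets
    \<open>ps\<close>, is not part of \<open>V'\<close>. The colours on \<open>V'\<close> are
    \<open>i - 1\<close> and \<open>i\<close>, while \<open>Q\<close> before \<open>x\<close> uses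
    only \<open>ps\<close> and smaller colours.\<close>
  moreover have "v \<notin> set ps \<and> i \<le> Suc (\<chi> v)" if "v \<in> V'" for v
    using that colour[of v i] colour[of v "i - 1"] i(1) by (auto simp: V'_def)
  ultimately have "set (butlast Q) \<inter> set P = {}" using Q(6) by fastforce
  moreover have "last Q \<in> {P ! 0, P ! 1}" "w (last_edge Q) < w {P ! 0, P ! 1}"
    unfolding P(2) xz(3) using N_edge[OF le i(2) xz(2)] Q(3) by auto
  ultimately obtain S where S: "increasing_path E w S" "{S ! 0, S ! 1} = {Q ! 0, Q ! 1}"
    "path_length S \<ge> path_length Q + path_length P - 1" "path_edges S \<subseteq> path_edges Q \<union> path_edges P"
    using increasing_path_attach[OF Q(1) increasing_path_mono[OF P(1) \<open>E' \<subseteq> E\<close>]] by blast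
  \<comment> \<open>For the piece, mere membership in \<open>E'\<close> bounds the height in the
    original table.\<close>
  have "height V E w g \<ge> h - Suc K * d" if "g \<in> path_edges S" for g
  proof -
    have "height V E w g \<ge> h - Suc i * d"
    proof (cases "g \<in> path_edges Q")
      case True
      then show ?thesis using Q(5)[OF True] by simp
    next
      case False
      then have "g \<in> E'" using that S(4) path_edges_subset[OF P(1)] by blast
      then show ?thesis using E'_edge by (auto simp: E'_def)
    qed
    moreover have "Suc i * d \<le> Suc K * d" using i(2) by (intro mult_le_mono1) simp
    ultimately show ?thesis by linarith
  qed
  \<comment> \<open>The \<open>i \<ge> 1\<close> steps of \<open>Q\<close> beyond \<open>ps\<close>
    make up for the edge that attaching may lose.\<close>
  then show ?thesis using S Q(2,4) P(3) i(1) by (intro exI[of _ S]) auto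
qed

subsection \<open>Iteration\<close>

text \<open>This is where the constant 70 is tested: \<open>Suc K \<le> 3 * X\<close>, a window has
  at most \<open>50 * X * A\<close> rows, and there are at most \<open>2 * (B / L\<^sup>2)\<close>
  rounds, in total \<open>300 / 4900 * (A * B)\<close> rows. Rounding up the number of rounds costs
  only a factor 2 because \<open>B \<ge> L\<^sup>2\<close>.\<close>

lemma height_budget:
  fixes X L A B :: real and K m :: nat
  assumes X: "X \<ge> 1" "L = 70 * X" and A: "A \<ge> 1" and B: "B \<ge> L\<^sup>2"
    and K: "K = nat \<lceil>X\<rceil>" and m: "m = nat \<lfloor>A\<rfloor>"
  shows "real (nat \<lceil>B / L\<^sup>2\<rceil> * (Suc K * (4 * Suc K * (3 * m + 1) + (m + 1)))) \<le> A * B"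
proof -
  have L: "L > 0" using X by simp
  then have B0: "B > 0" using B by (smt (verit) zero_less_power)
  have K': "real (Suc K) \<le> 3 * X" using X K by linarith
  have "real m \<le> A" using m A by linarith
  then have r: "real (3 * m + 1) \<le> 4 * A" and u: "real (m + 1) \<le> 2 * A" using A by auto
  have "real (4 * Suc K * (3 * m + 1)) \<le> 4 * (3 * X) * (4 * A)"
    unfolding of_nat_mult using K' r X by (intro mult_mono) auto
  moreover have "2 * A \<le> 2 * X * A" using A X mult_right_mono[of 1 X "2 * A"] by simp
  ultimately have "real (4 * Suc K * (3 * m + 1) + (m + 1)) \<le> 50 * X * A"
    unfolding of_nat_add[of "4 * Suc K * (3 * m + 1)"] using u by linarith
  then have "real (Suc K * (4 * Suc K * (3 * m + 1) + (m + 1))) \<le> 3 * X * (50 * X * A)"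
    unfolding of_nat_mult[of "Suc K"] using K' X by (intro mult_mono) auto
  moreover have "real (nat \<lceil>B / L\<^sup>2\<rceil>) \<le> 2 * (B / L\<^sup>2)"
  proof -
    have "1 \<le> B / L\<^sup>2" using B L by simp
    then show ?thesis by linarith
  qed
  ultimately have "real (nat \<lceil>B / L\<^sup>2\<rceil> * (Suc K * (4 * Suc K * (3 * m + 1) + (m + 1))))
      \<le> 2 * (B / L\<^sup>2) * (3 * X * (50 * X * A))"
    unfolding of_nat_mult[of "nat \<lceil>B / L\<^sup>2\<rceil>"] using B L by (intro mult_mono) auto
  also have "\<dots> = 300 / 4900 * (A * B)"
    using X by (simp add: field_simps power2_eq_square)
  also have "\<dots> \<le> A * B" using A B0 by simp
  finally show ?thesis .
qed

text \<open>Provides the size conditions of \<open>extend_increasing_path\<close> for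
  \<open>r = 3 * m + 1\<close>. The product is below \<open>2 ^ (2 * K + 1)\<close>, and
  \<open>A \<ge> 70 * log 2 n\<close> forces \<open>K \<le> m\<close>.\<close>

lemma few_colour_classes:
  fixes A :: real and n K m :: nat
  assumes n: "n \<ge> 2" and K: "K = nat \<lceil>log 2 n\<rceil>" and m: "m = nat \<lfloor>A\<rfloor>"
    and A: "A \<ge> 70 * log 2 n"
  shows "n \<le> 2 ^ K" "n * Suc K < 2 ^ (3 * m + 1)"
proof -
  define X where "X = log 2 (real n)"
  have X: "X \<ge> 1" using n by (simp add: X_def le_log_iff)
  have "real n = 2 powr X" using n by (simp add: X_def)
  also have "\<dots> \<le> 2 powr real K" using K by (intro powr_mono) (simp_all add: X_def real_nat_ceiling_ge)
  finally have "real n \<le> real (2 ^ K)" by (simp add: powr_realpow)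
  then show n2: "n \<le> 2 ^ K" by linarith
  have "n * Suc K < 2 ^ K * 2 ^ Suc K"
    using n n2 less_exp[of "Suc K"] by (intro mult_le_less_imp_less) auto
  also have "\<dots> = 2 ^ (2 * K + 1)" by (simp only: power_add[symmetric]) (simp add: mult_2)
  also have "\<dots> \<le> (2::nat) ^ (3 * m + 1)"
  proof (rule power_increasing)
    have "real K \<le> X + 1" using K X unfolding X_def by linarith
    moreover have "real m \<ge> 70 * X - 1" using m A unfolding X_def by linarith
    ultimately have "real K \<le> real m" using X by linarith
    then show "2 * K + 1 \<le> 3 * m + 1" by simp
  qed simp
  finally show "n * Suc K < 2 ^ (3 * m + 1)" .
qed

section \<open>The induction on \<open>t\<close>\<close>

lemma trivial_path:
  assumes "ordered_graph V E w" "e \<in> E"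
  shows "\<exists>ps. increasing_path E w ps \<and> {ps ! 0, ps ! 1} = e \<and> path_length ps = 1 \<and> path_edges ps = {e}"
proof -
  obtain x y where "x \<noteq> y" "e = {x, y}" using ordered_graph_edgeE[OF assms] by metis
  then show ?thesis using increasing_path_edge[of x y E] assms(2) by (intro exI[of _ "[x, y]"]) auto
qed

theorem theorem4p1:
  fixes V :: "'v::linorder set" and E :: "'v set set" and w :: "'v set \<Rightarrow> nat"
    and t :: nat and a :: real and e :: "'v set"
  assumes "t \<ge> 1"
    and "ordered_graph V E w"
    and "card V \<ge> 2"
    and "a > 0"
    and "e \<in> E"
    and "real (height V E w e) > a"
  shows "\<exists>ps. increasing_path E w ps \<and> {ps ! 0, ps ! 1} = e \<and>
     real (path_length ps) \<ge> a powr (1 - 1 / real t) / (70 * log 2 (real (card V))) ^ (2 * t) \<and>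
     (\<forall>f \<in> path_edges ps. real (height V E w f) \<ge> real (height V E w e) - a)"
  using assms
\<comment> \<open>The hypothesis is applied to subgraphs and to another threshold; \<open>w\<close>
  stays fixed, since subgraphs inherit the order.\<close>
proof (induction t arbitrary: V E a e rule: nat_induct_at_least)
  case base
  \<comment> \<open>For \<open>t = 1\<close> the numerator is \<open>a powr 0 = 1\<close> and the
    denominator is at least 1, so \<open>e\<close> alone is long enough.\<close>
  have "log 2 (real (card V)) \<ge> 1" using \<open>card V \<ge> 2\<close> by (simp add: le_log_iff)
  then have "1 \<le> (70 * log 2 (real (card V))) ^ 2" by (intro one_le_power) simp
  then have "a powr (1 - 1 / real 1) / (70 * log 2 (real (card V))) ^ (2 * 1) \<le> 1"
    using \<open>a > 0\<close> by (simp add: divide_le_eq)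
  moreover obtain ps where "increasing_path E w ps" "{ps ! 0, ps ! 1} = e" "path_length ps = 1"
    "path_edges ps = {e}"
    using trivial_path[OF base(1,4)] by blast
  ultimately show ?case using \<open>a > 0\<close> by (intro exI[of _ ps]) auto
next
  case (Suc t)
  note G = \<open>ordered_graph V E w\<close> and V2 = \<open>card V \<ge> 2\<close> and e = \<open>e \<in> E\<close>
  define X where "X = log 2 (real (card V))"
  define L where "L = 70 * X"
  \<comment> \<open>Then \<open>a = B ^ Suc t\<close>, and the hypothesis at
    \<open>A = B ^ t\<close> yields pieces of length \<open>B ^ (t - 1) / L ^ (2 * t)\<close>.
    Taking \<open>B / L\<^sup>2\<close> of them reaches the target \<open>l\<close>.\<close>
  define B where "B = a powr (1 / real (Suc t))"
  define A where "A = B ^ t"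
  define l where "l = A / L ^ (2 * Suc t)"
  have X: "X \<ge> 1" using V2 by (simp add: X_def le_log_iff)
  have L: "L \<ge> 70" using X by (simp add: L_def)
  have B0: "B > 0" using \<open>a > 0\<close> by (simp add: B_def)
  have "B ^ Suc t = B powr real (Suc t)" using B0 by (simp only: powr_realpow)
  also have "\<dots> = a" using \<open>a > 0\<close> by (simp only: B_def powr_powr) simp
  finally have "B ^ Suc t = a" .
  then have AB: "A * B = a" by (simp add: A_def mult.commute)
  have goal_len: "a powr (1 - 1 / real (Suc t)) / (70 * log 2 (real (card V))) ^ (2 * Suc t) = l"
  proof -
    have "A = a powr (real t / real (Suc t))"
      using \<open>a > 0\<close> by (simp add: A_def B_def powr_power)
    also have "real t / real (Suc t) = 1 - 1 / real (Suc t)" by (simp add: field_simps)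
    finally show ?thesis by (simp add: l_def L_def X_def)
  qed
  show ?case
    unfolding goal_len
  proof (cases "l \<le> 1")
    case True
    then show "\<exists>ps. increasing_path E w ps \<and> {ps ! 0, ps ! 1} = e \<and> real (path_length ps) \<ge> l \<and>
        (\<forall>f \<in> path_edges ps. real (height V E w f) \<ge> real (height V E w e) - a)"
      using trivial_path[OF G e] \<open>a > 0\<close> by fastforce
  next
    case False
    \<comment> \<open>Once a single edge is too short, \<open>A\<close> is so large that
      \<open>B \<ge> L\<^sup>2\<close>, as the budget requires.\<close>
    then have A_gt: "A > L ^ (2 * Suc t)" using L by (simp add: l_def field_simps)
    have "L ^ 1 \<le> L ^ (2 * Suc t)" using L by (intro power_increasing) auto
    then have AL: "A \<ge> L" using A_gt by simp
    have "(L\<^sup>2) ^ t \<le> L ^ (2 * Suc t)"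
      using L by (simp only: power_mult[symmetric]) (intro power_increasing, auto)
    then have "(L\<^sup>2) ^ t \<le> B ^ t" using A_gt by (simp add: A_def)
    then have BL: "B \<ge> L\<^sup>2" using B0 \<open>t \<ge> 1\<close> by (simp add: power_mono_iff)
    have lA: "l \<le> A"
      using L AL by (simp add: l_def divide_le_eq mult_ge1_I)
    define K where "K = nat \<lceil>X\<rceil>"
    \<comment> \<open>Heights are integers, so a height above \<open>m\<close> is a height above
      \<open>A\<close>.\<close>
    define m where "m = nat \<lfloor>A\<rfloor>"
    define p where "p = nat \<lceil>B ^ (t - 1) / L ^ (2 * t)\<rceil>"
    \<comment> \<open>The first summand serves the colouring with \<open>r = 3 * m + 1\<close>, the
      second allows for \<open>m + 1\<close> vertices already used.\<close>
    define d where "d = 4 * Suc K * (3 * m + 1) + (m + 1)"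
    define M where "M = nat \<lceil>B / L\<^sup>2\<rceil>"
    define H where "H = height V E w e"
    have budget': "real (M * (Suc K * d)) \<le> a"
      using height_budget[OF X L_def _ BL K_def m_def] AL L AB by (simp add: M_def d_def)
    then have budget: "M * (Suc K * d) < H"
      using \<open>real (height V E w e) > a\<close> unfolding H_def by linarith
    have colours: "card V \<le> 2 ^ K" "card V * Suc K < 2 ^ (3 * m + 1)"
      using few_colour_classes[OF V2 _ m_def, of K] AL by (simp_all add: K_def X_def L_def)
    \<comment> \<open>Passing to a subgraph only shrinks the logarithm, so \<open>p\<close>,
      computed from \<open>card V\<close>, is a valid bound in all of them.\<close>
    have sub: "\<exists>P. increasing_path E' w P \<and> {P ! 0, P ! 1} = f \<and> path_length P \<ge> p"
      if H: "V' \<subseteq> V" "E' \<subseteq> E" "ordered_graph V' E' w" "f \<in> E'" "height V' E' w f > m" for V' E' f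
    proof -
      have fin: "finite V" "finite V'"
        using ordered_graph_finite G H(3) by blast+
      have V'2: "card V' \<ge> 2"
      proof -
        obtain x y where "x \<in> V'" "y \<in> V'" "x \<noteq> y" using ordered_graph_edgeE[OF H(3,4)] by metis
        then show ?thesis using fin card_mono[of V' "{x, y}"] by auto
      qed
      have "A < real (height V' E' w f)" using H(5) m_def AL L by linarith
      then obtain P where P: "increasing_path E' w P" "{P ! 0, P ! 1} = f"
        "A powr (1 - 1 / real t) / (70 * log 2 (real (card V'))) ^ (2 * t) \<le> real (path_length P)"
        using Suc.IH[OF H(3) V'2 _ H(4), of A] AL L by auto
      have "A powr (1 - 1 / real t) = B ^ (t - 1)"
      proof -
        have "A powr (1 - 1 / real t) = B powr (real t * (1 - 1 / real t))"
          using B0 by (simp add: A_def powr_realpow[symmetric] powr_powr)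
        also have "real t * (1 - 1 / real t) = real (t - 1)"
          using \<open>t \<ge> 1\<close> by (simp add: field_simps of_nat_diff)
        finally show ?thesis using B0 by (simp add: powr_realpow)
      qed
      moreover have "(70 * log 2 (real (card V'))) ^ (2 * t) \<le> L ^ (2 * t)"
        using V'2 card_mono[OF fin(1) H(1)] by (intro power_mono) (auto simp: L_def X_def)
      moreover have "log 2 (real (card V')) > 0" using V'2 by simp
      ultimately have "B ^ (t - 1) / L ^ (2 * t) \<le> A powr (1 - 1 / real t) / (70 * log 2 (real (card V'))) ^ (2 * t)"
        using B0 L by (simp only:) (intro divide_left_mono mult_pos_pos zero_less_power, auto)
      then have "p \<le> path_length P" using P(3) unfolding p_def by linarith
      then show ?thesis using P by blast
    qed
    \<comment> \<open>A path that has reached length \<open>l\<close> is left alone. Before that,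
      \<open>l \<le> A\<close> limits it to \<open>m + 1\<close> vertices, as \<open>d\<close>
      presumes.\<close>
    have iterate: "\<exists>ps. increasing_path E w ps \<and> {ps ! 0, ps ! 1} = e \<and>
        (real (path_length ps) \<ge> l \<or> path_length ps \<ge> j * p) \<and>
        (\<forall>f\<in>path_edges ps. height V E w f \<ge> H - j * (Suc K * d))" if "j \<le> M" for j
      using that
    proof (induction j)
      case 0
      then show ?case using trivial_path[OF G e] by (fastforce simp: H_def)
    next
      case (Suc j)
      then obtain ps where ps: "increasing_path E w ps" "{ps ! 0, ps ! 1} = e"
        "real (path_length ps) \<ge> l \<or> path_length ps \<ge> j * p"
        "\<And>f. f \<in> path_edges ps \<Longrightarrow> height V E w f \<ge> H - j * (Suc K * d)"
        by auto
      show ?case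
      proof (cases "real (path_length ps) \<ge> l")
        case True
        then show ?thesis using ps by (intro exI[of _ ps]) fastforce
      next
        case False
        have "length ps \<le> m + 1"
          using False lA by (simp add: path_length_def m_def) linarith
        then have d: "4 * Suc K * (3 * m + 1) + length ps \<le> d" by (simp add: d_def)
        \<comment> \<open>All \<open>M\<close> rounds together cost less than \<open>H\<close>, so
          each round starts with more than \<open>Suc K * d\<close> rows left.\<close>
        have "Suc j * (Suc K * d) \<le> M * (Suc K * d)" using Suc.prems by (intro mult_le_mono1)
        then have h: "Suc K * d < H - j * (Suc K * d)" using budget by simp
        have "\<exists>R. increasing_path E w R \<and> {R ! 0, R ! 1} = {ps ! 0, ps ! 1} \<and>
            path_length ps + p \<le> path_length R \<and>
            (\<forall>f\<in>path_edges R. H - j * (Suc K * d) - Suc K * d \<le> height V E w f)"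
          by (rule extend_increasing_path[OF G V2 colours _ _ ps(1,4) d h, of m]) (simp, rule sub)
        then obtain R where R: "increasing_path E w R" "{R ! 0, R ! 1} = {ps ! 0, ps ! 1}"
          "path_length ps + p \<le> path_length R"
          "\<And>f. f \<in> path_edges R \<Longrightarrow> H - j * (Suc K * d) - Suc K * d \<le> height V E w f"
          by blast
        have "Suc j * p \<le> path_length R" using R(3) ps(3) False by simp
        moreover have "H - Suc j * (Suc K * d) \<le> height V E w f" if "f \<in> path_edges R" for f
          using R(4)[OF that] by simp
        ultimately show ?thesis using R(1,2) ps(2) by blast
      qed
    qed
    then obtain ps where ps: "increasing_path E w ps" "{ps ! 0, ps ! 1} = e"
      "real (path_length ps) \<ge> l \<or> path_length ps \<ge> M * p"
      "\<And>f. f \<in> path_edges ps \<Longrightarrow> height V E w f \<ge> H - M * (Suc K * d)"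
      by blast
    have "l \<le> real (M * p)"
    proof -
      have "l = B / L\<^sup>2 * (B ^ (t - 1) / L ^ (2 * t))"
        using \<open>t \<ge> 1\<close> by (cases t) (simp_all add: l_def A_def power_add power2_eq_square)
      also have "\<dots> \<le> real M * real p"
        unfolding M_def p_def using B0 L by (intro mult_mono real_nat_ceiling_ge of_nat_0_le_iff) auto
      finally show ?thesis by simp
    qed
    then have "l \<le> real (path_length ps)" using ps(3) by linarith
    \<comment> \<open>By \<open>budget\<close> the natural subtraction is not truncated, and
      \<open>budget'\<close> bounds the total loss by \<open>a\<close>.\<close>
    moreover have "real H - a \<le> real (height V E w f)" if "f \<in> path_edges ps" for f
      using ps(4)[OF that] budget' budget by linarith
    ultimately show "\<exists>ps. increasing_path E w ps \<and> {ps ! 0, ps ! 1} = e \<and> real (path_length ps) \<ge> l \<and>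
        (\<forall>f \<in> path_edges ps. real (height V E w f) \<ge> real (height V E w e) - a)"
      using ps(1,2) by (auto simp: H_def)
  qed
qed

end
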